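(* Let $t>0$, $\lambda>0$, $\eta_1>1$, $\eta_2>0$, and $p,q>0$ with $p+q=1$. Let $H_1(t,x)=\sum_{k=0}^\infty a_k(\log x)^k$ for $x>1$ and $H_2(t,x)=\sum_{k=0}^\infty b_k\left(\log\frac1x\right)^k$ for $0<x<1$, with the coefficients $a_k,b_k$ given in the context. Then $$H_1(t,x)=\frac{1}{2\sqrt{\pi}}(\eta_1\lambda tp)^{\frac14}\exp\left\{\frac{\eta_2\lambda tq}{\eta_1+\eta_2}-\lambda t\right\}(\log x)^{-\frac34}\exp\left\{2\sqrt{\eta_1\lambda tp}\sqrt{\log x}\right\}\left(1+O\left((\log x)^{-\frac12}\right)\right)$$ as $x\to\infty$, and $$H_2(t,x)=\frac{1}{2\sqrt{\pi}}(\eta_2\lambda tq)^{\frac14}\exp\left\{\frac{\eta_1\lambda tp}{\eta_1+\eta_2}-\lambda t\right\}\left(\log\frac1x\right)^{-\frac34}\exp\left\{2\sqrt{\eta_2\lambda tq}\sqrt{\log\frac1x}\right\}\left(1+O\left(\left(\log\frac1x\right)^{-\frac12}\right)\right)$$ as $x\to0$.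
   Context: Put $\pi_n=e^{-\lambda t}(\lambda t)^n/n!$ for $n\ge0$. For $1\le k\le n-1$, $$P_{n,k}=\sum_{i=k}^{n-1}\binom{n-k-1}{i-k}\binom{n}{i}\left(\frac{\eta_1}{\eta_1+\eta_2}\right)^{i-k}\left(\frac{\eta_2}{\eta_1+\eta_2}\right)^{n-i}p^iq^{n-i},$$ $$Q_{n,k}=\sum_{i=k}^{n-1}\binom{n-k-1}{i-k}\binom{n}{i}\left(\frac{\eta_1}{\eta_1+\eta_2}\right)^{n-i}\left(\frac{\eta_2}{\eta_1+\eta_2}\right)^{i-k}p^{n-i}q^i,$$ and $P_{n,n}=p^n$, $Q_{n,n}=q^n$. For $k\ge0$, $$a_k=\frac{\eta_1^{k+1}}{k!}\sum_{n=k+1}^\infty\pi_nP_{n,k+1},\qquad b_k=\frac{\eta_2^{k+1}}{k!}\sum_{n=k+1}^\infty\pi_nQ_{n,k+1}.$$ *)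

theory Defs
  imports "HOL-Analysis.Analysis" "HOL-Library.Landau_Symbols"
begin

definition poisson_wt :: "real \<Rightarrow> real \<Rightarrow> nat \<Rightarrow> real" where
  "poisson_wt lam t n = exp (- (lam * t)) * (lam * t) ^ n / fact n"

text \<open>
  \<open>P_coeff\<close> and \<open>Q_coeff\<close> are meant for \<open>1 \<le> k \<le> n\<close> only. In this range the index bounds
  \<open>k \<le> i < n\<close> ensure that no subtraction on naturals is truncated.
\<close>

definition P_coeff :: "real \<Rightarrow> real \<Rightarrow> real \<Rightarrow> real \<Rightarrow> nat \<Rightarrow> nat \<Rightarrow> real" where
  "P_coeff eta1 eta2 p q n k =
     (if k = n then p ^ n
      else \<Sum>i=k..<n. real ((n - k - 1) choose (i - k)) * real (n choose i)
             * (eta1 / (eta1 + eta2)) ^ (i - k) * (eta2 / (eta1 + eta2)) ^ (n - i)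
             * p ^ i * q ^ (n - i))"

definition Q_coeff :: "real \<Rightarrow> real \<Rightarrow> real \<Rightarrow> real \<Rightarrow> nat \<Rightarrow> nat \<Rightarrow> real" where
  "Q_coeff eta1 eta2 p q n k =
     (if k = n then q ^ n
      else \<Sum>i=k..<n. real ((n - k - 1) choose (i - k)) * real (n choose i)
             * (eta1 / (eta1 + eta2)) ^ (n - i) * (eta2 / (eta1 + eta2)) ^ (i - k)
             * p ^ (n - i) * q ^ i)"

text \<open>The series over \<open>n \<ge> k + 1\<close> are reindexed by \<open>n = m + (k + 1)\<close> with \<open>m \<ge> 0\<close>.\<close>

definition a_coeff :: "real \<Rightarrow> real \<Rightarrow> real \<Rightarrow> real \<Rightarrow> real \<Rightarrow> real \<Rightarrow> nat \<Rightarrow> real" where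
  "a_coeff lam eta1 eta2 p q t k =
     eta1 ^ (k + 1) / fact k *
       (\<Sum>m. poisson_wt lam t (m + (k + 1)) * P_coeff eta1 eta2 p q (m + (k + 1)) (k + 1))"

definition b_coeff :: "real \<Rightarrow> real \<Rightarrow> real \<Rightarrow> real \<Rightarrow> real \<Rightarrow> real \<Rightarrow> nat \<Rightarrow> real" where
  "b_coeff lam eta1 eta2 p q t k =
     eta2 ^ (k + 1) / fact k *
       (\<Sum>m. poisson_wt lam t (m + (k + 1)) * Q_coeff eta1 eta2 p q (m + (k + 1)) (k + 1))"

definition H1 :: "real \<Rightarrow> real \<Rightarrow> real \<Rightarrow> real \<Rightarrow> real \<Rightarrow> real \<Rightarrow> real \<Rightarrow> real" where
  "H1 lam eta1 eta2 p q t x = (\<Sum>k. a_coeff lam eta1 eta2 p q t k * (ln x) ^ k)"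

definition H2 :: "real \<Rightarrow> real \<Rightarrow> real \<Rightarrow> real \<Rightarrow> real \<Rightarrow> real \<Rightarrow> real \<Rightarrow> real" where
  "H2 lam eta1 eta2 p q t x = (\<Sum>k. b_coeff lam eta1 eta2 p q t k * (ln (1 / x)) ^ k)"

end

theory Submission
  imports Defs
begin

text \<open>
  Write \<open>c = eta1 lam t p\<close> and \<open>L = ln x\<close>. In the double sum over \<open>i = k + 1 + l\<close> and
  \<open>n - i\<close> that makes up \<open>a\<^sub>k\<close>, the terms with \<open>l = 0\<close> add up to
  \<open>exp (- lam t) c^(k + 1) exp (eta2 lam t q / (eta1 + eta2)) / (k! (k + 1)!)\<close>, and those with
  \<open>l \<ge> 1\<close> are smaller by a factor \<open>O(1 / (k + 2))\<close>. The leading part of the series is therefore a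
  multiple of \<open>S(y) = \<Sum>k. y^k / (k! (k + 1)!)\<close> at \<open>y = c L\<close>, which is a modified Bessel
  function: \<open>S(y) = I\<^sub>1(2 \<surd>y) / \<surd>y\<close>. The remainder is at most a multiple of
  \<open>\<Sum>k. y^k / (k! (k + 1)! (k + 2)) \<le> S(y) / \<surd>y\<close>, by the inequality between the arithmetic and
  geometric means.

  For \<open>S\<close> itself put \<open>z = 2 \<surd>y\<close>. Then
  \<open>S(y) = 2 / \<pi> \<integral> \<surd>(1 - u\<^sup>2) exp (z u) du\<close> over \<open>[-1, 1]\<close>, and substituting
  \<open>u = 1 - v / z\<close> and using \<open>1 - w \<le> \<surd>(1 - w) \<le> 1\<close> with \<open>w = v / (2 z)\<close> encloses the
  integral between two combinations of Gamma integrals which agree up to a factor \<open>1 - 3 / (4 z)\<close>.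
  The claim on \<open>H\<^sub>2\<close> follows from the symmetry that exchanges \<open>(eta1, p)\<close> and \<open>(eta2, q)\<close>.
\<close>

section \<open>Moments of the semicircle weight\<close>

text \<open>Integration by parts in disguise: \<open>u ^ (n + 1) * (1 - u^2) powr (3/2)\<close>
  vanishes at both endpoints, and its derivative is a combination of the two integrands with
  coefficients \<open>n + 1\<close> and \<open>- (n + 4)\<close>.\<close>

lemma has_integral_semicircle_moment_step:
  fixes n :: nat and m :: real
  assumes "((\<lambda>u. sqrt (1 - u\<^sup>2) * u ^ n) has_integral m) {-1..1}"
  shows "((\<lambda>u. sqrt (1 - u\<^sup>2) * u ^ (n + 2)) has_integral (real n + 1) / (real n + 4) * m) {-1..1}"
proof -
  have deriv: "((\<lambda>u. u ^ (n + 1) * (sqrt (1 - u\<^sup>2) * (1 - u\<^sup>2))) has_vector_derivative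
        ((real n + 1) * (sqrt (1 - u\<^sup>2) * u ^ n) - (real n + 4) * (sqrt (1 - u\<^sup>2) * u ^ (n + 2)))) (at u)"
    if "u \<in> {-1<..<1}" for u :: real
  proof -
    have pos: "1 - u\<^sup>2 > 0" using that by (simp add: abs_square_less_1 abs_less_iff)
    define s where "s = sqrt (1 - u\<^sup>2)"
    have s: "inverse s * (1 - u\<^sup>2) = s"
      using pos unfolding s_def by (auto simp: field_simps)
    have "((\<lambda>u. u ^ (n + 1)) has_real_derivative (real n + 1) * u ^ n) (at u)"
      using DERIV_pow[of "n + 1" u UNIV] by (simp add: add.commute)
    moreover have "((\<lambda>u. sqrt (1 - u\<^sup>2) * (1 - u\<^sup>2)) has_real_derivative
        inverse s / 2 * (- 2 * u) * (1 - u\<^sup>2) + s * (- 2 * u)) (at u)"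
      unfolding s_def using pos by (auto intro!: derivative_eq_intros simp: algebra_simps)
    ultimately have "((\<lambda>u. u ^ (n + 1) * (sqrt (1 - u\<^sup>2) * (1 - u\<^sup>2))) has_real_derivative
        ((real n + 1) * u ^ n * (s * (1 - u\<^sup>2)) +
          u ^ (n + 1) * (inverse s / 2 * (- 2 * u) * (1 - u\<^sup>2) + s * (- 2 * u)))) (at u)"
      unfolding s_def by (rule DERIV_mult'[THEN DERIV_cong]) simp
    also have "(real n + 1) * u ^ n * (s * (1 - u\<^sup>2)) +
          u ^ (n + 1) * (inverse s / 2 * (- 2 * u) * (1 - u\<^sup>2) + s * (- 2 * u))
        = (real n + 1) * u ^ n * (s * (1 - u\<^sup>2)) +
          u ^ (n + 1) * (- u * (inverse s * (1 - u\<^sup>2)) + s * (- 2 * u))"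
      by (simp add: algebra_simps)
    also have "\<dots> = (real n + 1) * (s * u ^ n) - (real n + 4) * (s * u ^ (n + 2))"
      unfolding s by (simp add: algebra_simps power2_eq_square)
    finally show ?thesis
      unfolding s_def has_real_derivative_iff_has_vector_derivative .
  qed
  \<comment> \<open>The derivative was computed with a division by \<open>sqrt (1 - u^2)\<close>,
    which is zero at both endpoints; hence the interior form of the fundamental theorem.\<close>
  have "((\<lambda>u. (real n + 1) * (sqrt (1 - u\<^sup>2) * u ^ n) - (real n + 4) * (sqrt (1 - u\<^sup>2) * u ^ (n + 2)))
      has_integral (1 ^ (n + 1) * (sqrt (1 - 1\<^sup>2) * (1 - 1\<^sup>2))
         - (-1) ^ (n + 1) * (sqrt (1 - (-1)\<^sup>2) * (1 - (-1)\<^sup>2)))) {-1..1}"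
    by (rule fundamental_theorem_of_calculus_interior[OF _ _ deriv]) (auto intro!: continuous_intros)
  then have "((\<lambda>u. (real n + 1) * (sqrt (1 - u\<^sup>2) * u ^ n) - (real n + 4) * (sqrt (1 - u\<^sup>2) * u ^ (n + 2)))
      has_integral 0) {-1..1}" by simp
  from has_integral_diff[OF has_integral_mult_right[OF assms, of "real n + 1"] this]
  have "((\<lambda>u. (real n + 4) * (sqrt (1 - u\<^sup>2) * u ^ (n + 2))) has_integral (real n + 1) * m) {-1..1}"
    by simp
  from has_integral_mult_right[OF this, of "1 / (real n + 4)"] show ?thesis
    by simp
qed

lemma has_integral_semicircle:
  "((\<lambda>u::real. sqrt (1 - u\<^sup>2)) has_integral pi / 2) {-1..1}"
proof -
  have deriv: "((\<lambda>u. (u * sqrt (1 - u\<^sup>2) + arcsin u) / 2) has_vector_derivative sqrt (1 - u\<^sup>2)) (at u)"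
    if "u \<in> {-1<..<1}" for u :: real
  proof -
    have pos: "1 - u\<^sup>2 > 0" using that by (simp add: abs_square_less_1 abs_less_iff)
    define s where "s = sqrt (1 - u\<^sup>2)"
    have s: "inverse s * (1 - u\<^sup>2) = s"
      using pos unfolding s_def by (auto simp: field_simps)
    have "((\<lambda>u. (u * sqrt (1 - u\<^sup>2) + arcsin u) / 2) has_real_derivative
        ((s + u * (inverse s / 2 * (- 2 * u)) + inverse s) / 2)) (at u)"
      unfolding s_def using pos that
      by (auto intro!: derivative_eq_intros)
    also have "(s + u * (inverse s / 2 * (- 2 * u)) + inverse s) / 2 = (s + inverse s * (1 - u\<^sup>2)) / 2"
      by (simp add: algebra_simps power2_eq_square)
    also have "\<dots> = s" unfolding s by simp
    finally show ?thesis
      unfolding s_def has_real_derivative_iff_has_vector_derivative .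
  qed
  have "((\<lambda>u. sqrt (1 - u\<^sup>2)) has_integral ((1 * sqrt (1 - 1\<^sup>2) + arcsin 1) / 2
      - ((-1) * sqrt (1 - (-1)\<^sup>2) + arcsin (-1)) / 2)) {-1..1}"
    by (rule fundamental_theorem_of_calculus_interior[OF _ _ deriv])
      (auto intro!: continuous_intros continuous_on_arcsin')
  then show ?thesis by simp
qed

text \<open>The recursion started at the area \<open>pi / 2\<close> of the half disc. The moments
  are \<open>pi / 2\<close> times the Catalan numbers divided by \<open>4 ^ k\<close>.\<close>

lemma has_integral_semicircle_even_moment:
  "((\<lambda>u. sqrt (1 - u\<^sup>2) * u ^ (2 * k)) has_integral
      pi / 2 * (fact (2 * k) / (4 ^ k * fact k * fact (k + 1)))) {-1..1::real}"
proof (induction k)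
  case 0
  then show ?case using has_integral_semicircle by simp
next
  case (Suc k)
  have eq: "2 * k + 2 = 2 * Suc k" by simp
  have fs: "fact (2 * Suc k) = (2 * real k + 2) * (2 * real k + 1) * (fact (2 * k) :: real)"
    "fact (Suc k + 1) = (real k + 2) * (real k + 1) * (fact k :: real)"
    "fact (Suc k) = (real k + 1) * (fact k :: real)" "fact (k + 1) = (real k + 1) * (fact k :: real)"
    by (simp_all add: algebra_simps)
  have "(real (2 * k) + 1) / (real (2 * k) + 4) * (pi / 2 * (fact (2 * k) / (4 ^ k * fact k * fact (k + 1))))
     = pi / 2 * (fact (2 * Suc k) / (4 ^ Suc k * fact (Suc k) * fact (Suc k + 1)))"
    unfolding fs by (simp add: divide_simps) (simp add: algebra_simps)
  with has_integral_semicircle_moment_step[OF Suc] show ?case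
    unfolding eq by metis
qed

text \<open>Reflection of the interval settles the first moment, and the recursion multiplies zero
  by a constant.\<close>

lemma has_integral_semicircle_odd_moment:
  "((\<lambda>u. sqrt (1 - u\<^sup>2) * u ^ (2 * k + 1)) has_integral 0) {-1..1::real}"
proof (induction k)
  case 0
  define f where "f = (\<lambda>u::real. sqrt (1 - u\<^sup>2) * u)"
  have "f integrable_on {-1..1}"
    unfolding f_def by (intro integrable_continuous_interval continuous_intros)
  then obtain I where I: "(f has_integral I) {-1..1}" by blast
  have "((\<lambda>u. f (- u)) has_integral I) {-1..1}"
    using I has_integral_reflect_real[where f = f and i = I and a = "-1" and b = 1] by simp
  moreover have "(\<lambda>u. f (- u)) = (\<lambda>u. - f u)" by (simp add: f_def)
  ultimately have "((\<lambda>u. - f u) has_integral I) {-1..1}" by simp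
  from has_integral_unique[OF has_integral_neg[OF I] this] have "I = 0" by simp
  with I show ?case by (simp add: f_def)
next
  case (Suc k)
  have eq: "2 * k + 1 + 2 = 2 * Suc k + 1" by simp
  show ?case using has_integral_semicircle_moment_step[OF Suc] unfolding eq by simp
qed

section \<open>The Bessel series\<close>

definition bessel_term :: "real \<Rightarrow> nat \<Rightarrow> real" where
  "bessel_term y k = y ^ k / (fact k * fact (k + 1))"

lemma bessel_term_nonneg: "0 \<le> y \<Longrightarrow> 0 \<le> bessel_term y k"
  by (simp add: bessel_term_def)

lemma summable_bessel_term:
  assumes "0 \<le> y"
  shows "summable (bessel_term y)"
proof (rule summable_comparison_test')
  show "summable (\<lambda>k. inverse (fact k) * y ^ k)" by (rule summable_exp)
  show "norm (bessel_term y k) \<le> inverse (fact k) * y ^ k" if "k \<ge> 0" for k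
  proof -
    have "y ^ k / fact k \<ge> y ^ k / (fact k * fact (k + 1))"
      using assms by (intro divide_left_mono) (auto simp: fact_ge_1 simp del: fact_Suc)
    then show ?thesis using assms by (simp add: bessel_term_def field_simps del: fact_Suc)
  qed
qed

text \<open>Expand \<open>exp (z * u)\<close> and integrate term by term. The odd moments drop out;
  in the even ones the factor \<open>fact (2 * k)\<close> cancels against the exponential series,
  which leaves \<open>bessel_term\<close> at \<open>z^2 / 4\<close>.\<close>

lemma has_integral_bessel:
  assumes "0 < z"
  shows "((\<lambda>u. sqrt (1 - u\<^sup>2) * exp (z * u)) has_integral
    pi / 2 * suminf (bessel_term (z\<^sup>2 / 4))) {-1..1}"
proof -
  define f where "f = (\<lambda>n u::real. sqrt (1 - u\<^sup>2) * (inverse (fact n) * (z * u) ^ n))"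
  define M where "M = (\<lambda>n. inverse (fact n) * z ^ n)"
  \<comment> \<open>On the interval both the weight and \<open>\<bar>u\<bar> ^ n\<close> are at most
    1, so the exponential series at \<open>z\<close> is a majorant.\<close>
  have bound: "norm (f n u) \<le> M n" if "u \<in> {-1..1}" for n u
  proof -
    have 1: "\<bar>u\<bar> ^ n \<le> 1" using that by (intro power_le_one) auto
    have 2: "0 \<le> 1 - u\<^sup>2" using that by (simp add: abs_square_le_1 abs_le_iff)
    have "norm (f n u) = sqrt (1 - u\<^sup>2) * (M n * \<bar>u\<bar> ^ n)"
      using assms 2 by (simp add: f_def M_def abs_mult power_mult_distrib power_abs)
    also have "\<dots> \<le> 1 * (M n * 1)"
      using 1 2 assms by (intro mult_mono) (auto simp: M_def)
    finally show ?thesis by simp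
  qed
  have "summable M" unfolding M_def by (rule summable_exp)
  from Weierstrass_m_test[OF bound this]
  have "uniform_limit {-1..1} (\<lambda>n u. \<Sum>i<n. f i u) (\<lambda>u. \<Sum>i. f i u) sequentially" .
  moreover have "(\<lambda>u. \<Sum>i. f i u) = (\<lambda>u. sqrt (1 - u\<^sup>2) * exp (z * u))"
  proof
    fix u
    have "(\<lambda>i. f i u) sums (sqrt (1 - u\<^sup>2) * exp (z * u))"
      unfolding f_def using sums_mult[OF exp_converges[of "z * u"], of "sqrt (1 - u\<^sup>2)"]
      by (simp add: scaleR_conv_of_real)
    then show "(\<Sum>i. f i u) = sqrt (1 - u\<^sup>2) * exp (z * u)" by (simp add: sums_iff)
  qed
  ultimately have ul: "uniform_limit {-1..1} (\<lambda>n u. \<Sum>i<n. f i u)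
      (\<lambda>u. sqrt (1 - u\<^sup>2) * exp (z * u)) sequentially" by simp
  have cont: "continuous_on {-1..1} (\<lambda>u. \<Sum>i<n. f i u)" for n
    unfolding f_def by (intro continuous_intros)
  obtain I J where I: "\<And>n. ((\<lambda>u. \<Sum>i<n. f i u) has_integral I n) {-1..1}"
    and J: "((\<lambda>u. sqrt (1 - u\<^sup>2) * exp (z * u)) has_integral J) {-1..1}"
    and lim: "I \<longlonglongrightarrow> J"
    using uniform_limit_integral[OF ul cont trivial_limit_sequentially] by blast
  define m where "m = (\<lambda>n. if even n then pi / 2 * bessel_term (z\<^sup>2 / 4) (n div 2) else 0)"
  have m: "(f n has_integral m n) {-1..1}" for n
  proof (cases "even n")
    case True
    then obtain k where k: "n = 2 * k" by blast
    have "inverse (fact n) * z ^ n * (pi / 2 * (fact (2 * k) / (4 ^ k * fact k * fact (k + 1)))) = m n"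
      by (simp add: k m_def bessel_term_def power_mult[symmetric] power_divide field_simps del: fact_Suc)
    with has_integral_mult_right[OF has_integral_semicircle_even_moment[of k], of "inverse (fact n) * z ^ n"]
    show ?thesis unfolding f_def by (simp add: k power_mult_distrib mult_ac del: fact_Suc)
  next
    case False
    then obtain k where k: "n = 2 * k + 1" by (rule oddE)
    with False has_integral_mult_right[OF has_integral_semicircle_odd_moment[of k], of "inverse (fact n) * z ^ n"]
    show ?thesis unfolding f_def by (simp add: k m_def power_mult_distrib mult_ac del: fact_Suc)
  qed
  have "I n = (\<Sum>i<n. m i)" for n
    by (rule has_integral_unique[OF I]) (intro has_integral_sum m, simp)
  then have "I = (\<lambda>n. \<Sum>i<n. m i)" by (rule ext)
  then have "m sums J" using lim by (simp add: sums_def)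
  \<comment> \<open>\<open>m\<close> vanishes at odd indices, so passing to the even ones keeps the
    sum.\<close>
  have "(\<lambda>k. m (2 * k)) sums J"
    using \<open>m sums J\<close> by (subst sums_mono_reindex[of "\<lambda>k. 2 * k"])
      (auto simp: strict_mono_def m_def elim!: evenE)
  then have "(\<lambda>k. pi / 2 * bessel_term (z\<^sup>2 / 4) k) sums J" by (simp add: m_def)
  moreover have "(\<lambda>k. pi / 2 * bessel_term (z\<^sup>2 / 4) k) sums (pi / 2 * suminf (bessel_term (z\<^sup>2 / 4)))"
    by (intro sums_mult summable_sums summable_bessel_term) simp
  ultimately show ?thesis using J sums_unique2 by blast
qed

section \<open>Enclosure of the Bessel integral by Gamma integrals\<close>

lemma Gamma_three_halves: "Gamma (3 / 2 :: real) = sqrt pi / 2"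
  using Gamma_plus1[of "1 / 2 :: real"] nonpos_Ints_nonpos[of "1 / 2 :: real"]
  by (auto simp: Gamma_one_half_real)

lemma Gamma_five_halves: "Gamma (5 / 2 :: real) = 3 / 2 * (sqrt pi / 2)"
  using Gamma_plus1[of "3 / 2 :: real"] nonpos_Ints_nonpos[of "3 / 2 :: real"]
  by (auto simp: Gamma_three_halves)

lemma le_sqrt_self:
  fixes x :: real
  assumes "0 \<le> x" "x \<le> 1"
  shows "x \<le> sqrt x"
  using assms by (intro real_le_rsqrt) (simp add: power2_eq_square mult_left_le)

text \<open>For large \<open>z\<close> the mass sits near \<open>u = 1\<close>, at distance of order
  \<open>1 / z\<close>. The leading constant is Gamma(3/2), and the correction is Gamma(5/2) / (2 z)
  relative to it, that is 3 / (4 z).\<close>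

lemma bessel_integral_bounds:
  assumes "0 < z" and J: "((\<lambda>u. sqrt (1 - u\<^sup>2) * exp (z * u)) has_integral J) {-1..1}"
  shows "J \<le> exp z / z * sqrt (2 / z) * (sqrt pi / 2)"
    and "exp z / z * sqrt (2 / z) * (sqrt pi / 2) * (1 - 3 / (4 * z)) \<le> J"
proof -
  define C where "C = exp z * sqrt (2 / z)"
  define h where "h = (\<lambda>v. sqrt (1 - (1 - v / z)\<^sup>2) * exp (z * (1 - v / z)))"
  have h_eq: "h v = C * (sqrt v * sqrt (1 - v / (2 * z)) / exp v)" for v
  proof -
    have "1 - (1 - v / z)\<^sup>2 = 2 / z * (v * (1 - v / (2 * z)))"
      using assms by (simp add: field_simps power2_eq_square)
    moreover have "exp (z * (1 - v / z)) = exp z / exp v"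
      using assms by (simp add: exp_diff algebra_simps)
    ultimately show ?thesis
      unfolding h_def C_def by (simp add: real_sqrt_mult real_sqrt_divide)
  qed
  \<comment> \<open>This is the range of \<open>v = z - z * u\<close>, in the form in which
    \<open>has_integral_affinity\<close> delivers it. The Jacobian turns \<open>J\<close> into
    \<open>z * J\<close>.\<close>
  have img: "(\<lambda>u. (1 / (- 1 / z)) *\<^sub>R u + - ((1 / (- 1 / z)) *\<^sub>R 1)) ` cbox (- 1) 1 = {0..2 * z}"
  proof -
    have "(\<lambda>u. (1 / (- 1 / z)) *\<^sub>R u + - ((1 / (- 1 / z)) *\<^sub>R 1)) = (\<lambda>u. (- z) * u + z)" by (auto simp: algebra_simps)
    then show ?thesis using assms image_affinity_atLeastAtMost[of "- z" z "- 1" 1] by simp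
  qed
  have "(h has_integral z * J) {0..2 * z}"
    using has_integral_affinity[OF J[folded cbox_interval], of "- 1 / z" 1] assms
    unfolding img by (simp add: h_def algebra_simps)
  \<comment> \<open>Extension by zero allows a pointwise comparison with the Gamma integrands on the
    whole half line.\<close>
  then have h: "((\<lambda>v. if v \<in> {0..2 * z} then h v else 0) has_integral z * J) {0..}"
    using has_integral_restrict[of "{0..2*z}" "{0..}" h "z * J"] by auto
  have G3: "((\<lambda>v. v powr (1 / 2) / exp v) has_integral sqrt pi / 2) {0..}"
    using Gamma_integral_real[of "3 / 2"] by (simp add: Gamma_three_halves)
  have G5: "((\<lambda>v. v powr (3 / 2) / exp v) has_integral 3 / 2 * (sqrt pi / 2)) {0..}"
    using Gamma_integral_real[of "5 / 2"] by (simp add: Gamma_five_halves)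
  have Cpos: "C > 0" using assms by (simp add: C_def)
  have "z * J \<le> C * (sqrt pi / 2)"
  proof (rule has_integral_le[OF h has_integral_mult_right[OF G3]])
    fix v :: real assume v: "v \<in> {0..}"
    have "sqrt v * sqrt (1 - v / (2 * z)) \<le> sqrt v * 1" if "v \<le> 2 * z"
      using v that assms by (intro mult_left_mono) auto
    then show "(if v \<in> {0..2 * z} then h v else 0) \<le> C * (v powr (1 / 2) / exp v)"
      using v Cpos by (auto simp: h_eq powr_half_sqrt intro!: mult_left_mono divide_right_mono)
  qed
  then show "J \<le> exp z / z * sqrt (2 / z) * (sqrt pi / 2)"
    using assms by (simp add: C_def field_simps)
  have "C * (sqrt pi / 2 - 1 / (2 * z) * (3 / 2 * (sqrt pi / 2))) \<le> z * J"
  proof (rule has_integral_le[OF has_integral_mult_right[OF has_integral_diff[OF G3 has_integral_mult_right[OF G5]]] h])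
    fix v :: real assume v: "v \<in> {0..}"
    have "v powr (3 / 2) = v * sqrt v"
      using v powr_add[of v 1 "1/2"] by (simp add: powr_half_sqrt)
    then have L: "v powr (1 / 2) / exp v - 1 / (2 * z) * (v powr (3 / 2) / exp v)
        = sqrt v * (1 - v / (2 * z)) / exp v"
      using v assms by (simp add: powr_half_sqrt field_simps)
    \<comment> \<open>Beyond \<open>2 z\<close> the minorant is nonpositive, so no tail estimate is needed.\<close>
    show "C * (v powr (1 / 2) / exp v - 1 / (2 * z) * (v powr (3 / 2) / exp v))
        \<le> (if v \<in> {0..2 * z} then h v else 0)"
    proof (cases "v \<le> 2 * z")
      case True
      then have "1 - v / (2 * z) \<le> sqrt (1 - v / (2 * z))"
        using v assms by (intro le_sqrt_self) auto
      then have "sqrt v * (1 - v / (2 * z)) / exp v \<le> sqrt v * sqrt (1 - v / (2 * z)) / exp v"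
        using v by (intro divide_right_mono mult_left_mono) auto
      from mult_left_mono[OF this, of C] show ?thesis using True v Cpos unfolding L h_eq by simp
    next
      case False
      then have "1 - v / (2 * z) \<le> 0" using assms by simp
      then have "sqrt v * (1 - v / (2 * z)) / exp v \<le> 0"
        using v by (intro divide_nonpos_pos mult_nonneg_nonpos) auto
      from mult_left_mono[OF this, of C] show ?thesis using False Cpos unfolding L by simp
    qed
  qed
  then show "exp z / z * sqrt (2 / z) * (sqrt pi / 2) * (1 - 3 / (4 * z)) \<le> J"
    using assms by (simp add: C_def field_simps)
qed

text \<open>The leading term of \<open>I\<^sub>1(2 \<surd>y) / \<surd>y\<close> as \<open>y \<rightarrow> \<infinity>\<close>.\<close>

definition bessel_main :: "real \<Rightarrow> real" where
  "bessel_main y = 1 / (2 * sqrt pi) * y powr (- (3/4)) * exp (2 * sqrt y)"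

text \<open>The factor \<open>2 / pi\<close> undoes the one in \<open>has_integral_bessel\<close>.
  The exponent -3/4 is made up of -1/2 from \<open>1 / z\<close> and -1/4 from
  \<open>sqrt (2 / z)\<close>.\<close>

lemma bessel_main_eq:
  assumes "0 < y" and z: "z = 2 * sqrt y"
  shows "2 / pi * (exp z / z * sqrt (2 / z) * (sqrt pi / 2)) = bessel_main y"
proof -
  have 1: "sqrt (2 / z) = y powr (- (1/4))"
    using assms by (simp add: powr_powr powr_minus powr_divide divide_simps flip: powr_half_sqrt)
  have 2: "1 / z = y powr (- (1/2)) / 2"
    using assms by (simp add: powr_minus powr_half_sqrt field_simps)
  have 3: "y powr (- (1/2)) * y powr (- (1/4)) = y powr (- (3/4))"
    by (simp flip: powr_add)
  have 4: "sqrt pi / pi = 1 / sqrt pi"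
    by (simp add: field_simps)
  have "2 / pi * (exp z / z * sqrt (2 / z) * (sqrt pi / 2)) = (sqrt pi / pi) * ((1 / z) * sqrt (2 / z)) * exp z"
    by simp
  also have "\<dots> = 1 / (2 * sqrt pi) * (y powr (- (1/2)) * y powr (- (1/4))) * exp z"
    unfolding 1 2 4 by simp
  finally show ?thesis unfolding 3 z bessel_main_def .
qed

text \<open>At \<open>z = 2 * sqrt y\<close> the correction 3 / (4 z) becomes 3 / (8 sqrt y). Both
  bounds hold for each positive \<open>y\<close>, not only in the limit.\<close>

lemma bessel_series_bounds:
  assumes "0 < y"
  shows "suminf (bessel_term y) \<le> bessel_main y"
    and "bessel_main y * (1 - 3 / (8 * sqrt y)) \<le> suminf (bessel_term y)"
proof -
  define z where "z = 2 * sqrt y"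
  have z: "0 < z" "z\<^sup>2 / 4 = y" using assms by (auto simp: z_def power_mult_distrib)
  note J = has_integral_bessel[OF z(1), unfolded z(2)]
  note bounds = bessel_integral_bounds[OF z(1) J]
  have eq: "2 / pi * (pi / 2 * S) = S" for S by simp
  show "suminf (bessel_term y) \<le> bessel_main y"
    using mult_left_mono[OF bounds(1), of "2 / pi"]
    unfolding eq bessel_main_eq[OF assms z_def] by simp
  show "bessel_main y * (1 - 3 / (8 * sqrt y)) \<le> suminf (bessel_term y)"
    using mult_left_mono[OF bounds(2), of "2 / pi"]
    unfolding eq mult.assoc[symmetric]
    unfolding bessel_main_eq[OF assms z_def, unfolded mult.assoc[symmetric]]
    by (simp add: z_def)
qed

section \<open>The remainder series with the extra factor 1 / (k + 2)\<close>

lemma bessel_term_Suc: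
  "bessel_term y (Suc k) = y / ((real k + 1) * (real k + 2)) * bessel_term y k"
  by (simp add: bessel_term_def field_simps)

text \<open>With \<open>s = sqrt y\<close> and \<open>d = k + 2\<close>, the square of
  \<open>1 - s / d\<close> gives \<open>2 * s / d \<le> 1 + y / d^2\<close>. Lowering one factor
  \<open>d\<close> to \<open>k + 1\<close> turns the last quotient into the ratio of consecutive
  terms.\<close>

lemma bessel_term_divide_le:
  assumes "0 < y"
  shows "bessel_term y k / (real k + 2) \<le> (bessel_term y k + bessel_term y (Suc k)) / (2 * sqrt y)"
proof -
  define s d where "s = sqrt y" and "d = real k + 2"
  have s: "s > 0" "s\<^sup>2 = y" and d: "d > 0" "real k + 1 > 0" "real k + 1 \<le> d"
    using assms by (auto simp: s_def d_def)
  have "0 \<le> (1 - s / d)\<^sup>2" by simp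
  then have "2 * s / d \<le> 1 + s\<^sup>2 / (d * d)"
    using d by (simp add: power2_eq_square field_simps)
  also have "s\<^sup>2 / (d * d) \<le> y / ((real k + 1) * d)"
    using d assms unfolding s(2) by (intro divide_left_mono mult_right_mono) auto
  finally have "1 / d \<le> (1 + y / ((real k + 1) * d)) / (2 * s)"
    using s d by (simp add: field_simps)
  from mult_right_mono[OF this bessel_term_nonneg, of y k] assms show ?thesis
    unfolding bessel_term_Suc s_def[symmetric] d_def[symmetric]
    by (simp add: algebra_simps add_divide_distrib)
qed

lemma bessel_term_divide_sum:
  assumes "0 < y"
  shows "summable (\<lambda>k. bessel_term y k / (real k + 2))"
    and "(\<Sum>k. bessel_term y k / (real k + 2)) \<le> suminf (bessel_term y) / sqrt y"
proof -
  have sb: "summable (bessel_term y)" using assms by (intro summable_bessel_term) simp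
  then have sb': "summable (\<lambda>k. bessel_term y (Suc k))" by (simp add: summable_Suc_iff)
  note le = bessel_term_divide_le[OF assms]
  have sr: "summable (\<lambda>k. (bessel_term y k + bessel_term y (Suc k)) / (2 * sqrt y))"
    by (intro summable_divide summable_add sb sb')
  show sl: "summable (\<lambda>k. bessel_term y k / (real k + 2))"
    by (rule summable_comparison_test'[OF sr]) (use le bessel_term_nonneg[of y] assms in auto)
  have "(\<Sum>k. bessel_term y k / (real k + 2)) \<le> (\<Sum>k. (bessel_term y k + bessel_term y (Suc k)) / (2 * sqrt y))"
    by (rule suminf_le[OF le sl sr])
  also have "\<dots> = (suminf (bessel_term y) + (\<Sum>k. bessel_term y (Suc k))) / (2 * sqrt y)"
    using sb sb' by (simp add: suminf_divide summable_add suminf_add)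
  \<comment> \<open>The shifted series only loses a nonnegative head, so the two series together
    contribute at most twice the full sum, which cancels the 2 in the denominator.\<close>
  also have "(\<Sum>k. bessel_term y (Suc k)) \<le> suminf (bessel_term y)"
    using suminf_split_head[OF sb] bessel_term_nonneg[of y 0] assms by simp
  finally show "(\<Sum>k. bessel_term y k / (real k + 2)) \<le> suminf (bessel_term y) / sqrt y"
    using assms by (simp add: divide_right_mono)
qed

section \<open>Bounds on the coefficients and their series\<close>

text \<open>Equivalently, \<open>K + l\<close> choose \<open>l\<close> is at least
  \<open>K + 1\<close>. This is the source of the gain \<open>1 / (K + 1)\<close> in all terms with
  \<open>l \<ge> 1\<close>.\<close>

lemma fact_add_ge:
  assumes "1 \<le> l"
  shows "fact K * (real K + 1) * fact l \<le> fact (K + l)"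
  using assms
proof (induction l rule: dec_induct)
  case base
  then show ?case by simp
next
  case (step l)
  have "fact K * (real K + 1) * fact (Suc l) = (real l + 1) * (fact K * (real K + 1) * fact l)"
    by simp
  also have "\<dots> \<le> (real (K + l) + 1) * fact (K + l)"
    using step.IH by (intro mult_mono) auto
  finally show ?case by (simp add: add_ac)
qed

lemma binomial_exp_term:
  fixes a b :: real
  shows "(a + b) ^ m / fact m = (\<Sum>l\<le>m. a ^ l * b ^ (m - l) / (fact l * fact (m - l)))"
  unfolding binomial_ring sum_divide_distrib
  by (intro sum.cong refl) (simp add: binomial_fact)

text \<open>Put \<open>n = m + K\<close> and \<open>i = K + l\<close>: the \<open>fact n\<close> in
  the binomial coefficient cancels the one in the Poisson weight. For \<open>m = 0\<close> the
  diagonal value of \<open>P_coeff\<close> applies instead of the sum.\<close>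

lemma poisson_P_coeff_eq:
  assumes "0 < m"
  shows "poisson_wt lam t (m + K) * P_coeff eta1 eta2 p q (m + K) K =
    exp (- (lam * t)) * (lam * t * p) ^ K *
      (\<Sum>l<m. real ((m - 1) choose l) * (eta1 / (eta1 + eta2) * (lam * t * p)) ^ l *
         (eta2 / (eta1 + eta2) * (lam * t * q)) ^ (m - l) / (fact (K + l) * fact (m - l)))"
proof -
  have "P_coeff eta1 eta2 p q (m + K) K = (\<Sum>i=0 + K..<m + K. real ((m + K - K - 1) choose (i - K)) * real ((m + K) choose i)
             * (eta1 / (eta1 + eta2)) ^ (i - K) * (eta2 / (eta1 + eta2)) ^ (m + K - i)
             * p ^ i * q ^ (m + K - i))"
    using assms by (simp add: P_coeff_def)
  also have "\<dots> = (\<Sum>l<m. real ((m - 1) choose l) * real ((m + K) choose (l + K))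
             * (eta1 / (eta1 + eta2)) ^ l * (eta2 / (eta1 + eta2)) ^ (m - l)
             * p ^ (l + K) * q ^ (m - l))"
    unfolding sum.shift_bounds_nat_ivl by (simp add: atLeast0LessThan)
  finally have P: "P_coeff eta1 eta2 p q (m + K) K = \<dots>" .
  show ?thesis
    unfolding P sum_distrib_left
  proof (rule sum.cong[OF refl])
    fix l assume "l \<in> {..<m}"
    then have "l < m" by simp
    then have b: "real ((m + K) choose (l + K)) = fact (m + K) / (fact (K + l) * fact (m - l))"
      using binomial_fact[of "l + K" "m + K", where 'a = real] by (simp add: add.commute)
    have w: "poisson_wt lam t (m + K) = exp (- (lam * t)) * ((lam * t) ^ K * (lam * t) ^ l * (lam * t) ^ (m - l)) / fact (m + K)"
      using \<open>l < m\<close> by (simp add: poisson_wt_def add.commute flip: power_add)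
    define r s x where "r = eta1 / (eta1 + eta2)" and "s = eta2 / (eta1 + eta2)" and "x = lam * t"
    show "poisson_wt lam t (m + K) * (real ((m - 1) choose l) * real ((m + K) choose (l + K))
             * (eta1 / (eta1 + eta2)) ^ l * (eta2 / (eta1 + eta2)) ^ (m - l)
             * p ^ (l + K) * q ^ (m - l)) =
      exp (- (lam * t)) * (lam * t * p) ^ K * (real ((m - 1) choose l) * (eta1 / (eta1 + eta2) * (lam * t * p)) ^ l *
         (eta2 / (eta1 + eta2) * (lam * t * q)) ^ (m - l) / (fact (K + l) * fact (m - l)))"
      unfolding b w r_def[symmetric] s_def[symmetric] x_def[symmetric]
      by (simp add: power_mult_distrib power_add)
  qed
qed

text \<open>The term \<open>l = 0\<close> is exactly \<open>E * (v ^ m / fact m)\<close>. In the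
  others the binomial coefficient is at most \<open>2 ^ m\<close>, and \<open>fact_add_ge\<close>
  separates \<open>K\<close> from \<open>l\<close>, so that the binomial theorem resums them. The
  crude \<open>2 ^ m\<close> merely doubles the argument of an exponential constant.\<close>

lemma poisson_P_coeff_bounds:
  fixes lam t eta1 eta2 p q :: real and K m :: nat
  assumes "t > 0" "lam > 0" "eta1 > 0" "eta2 > 0" "p > 0" "q > 0"
  defines "u \<equiv> eta1 / (eta1 + eta2) * (lam * t * p)" and "v \<equiv> eta2 / (eta1 + eta2) * (lam * t * q)"
    and "E \<equiv> exp (- (lam * t)) * (lam * t * p) ^ K / fact K"
    and "f \<equiv> (\<lambda>m. poisson_wt lam t (m + K) * P_coeff eta1 eta2 p q (m + K) K)"
  shows "E * (v ^ m / fact m) \<le> f m"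
    and "f m \<le> E * (v ^ m / fact m + 1 / (real K + 1) * ((2 * (u + v)) ^ m / fact m))"
proof -
  have pos: "u > 0" "v > 0" "E > 0" using assms by auto
  have *: "E * (v ^ m / fact m) \<le> f m \<and>
      f m \<le> E * (v ^ m / fact m + 1 / (real K + 1) * ((2 * (u + v)) ^ m / fact m))"
  proof (cases "m = 0")
    \<comment> \<open>On the diagonal \<open>P_coeff\<close> is \<open>p ^ K\<close>, and the value
      is \<open>E\<close> itself.\<close>
    case True
    have "f m = E"
      by (simp add: True f_def E_def P_coeff_def poisson_wt_def power_mult_distrib)
    then show ?thesis using pos True by simp
  next
    case False
    define T where "T = (\<lambda>l. real ((m - 1) choose l) * u ^ l * v ^ (m - l) * fact K / (fact (K + l) * fact (m - l)))"
    have "f m = E * (\<Sum>l<m. T l)"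
      unfolding f_def T_def E_def sum_distrib_left u_def v_def
      using False by (subst poisson_P_coeff_eq) (auto simp: sum_distrib_left intro!: sum.cong)
    also have "(\<Sum>l<m. T l) = T 0 + (\<Sum>l\<in>{1..<m}. T l)"
      using False by (simp add: sum.atLeast_Suc_lessThan flip: atLeast0LessThan)
    also have "T 0 = v ^ m / fact m" by (simp add: T_def)
    finally have f: "f m = E * (v ^ m / fact m + (\<Sum>l\<in>{1..<m}. T l))" .
    have T0: "T l \<ge> 0" for l using pos by (simp add: T_def)
    have T1: "T l \<le> 1 / (real K + 1) * 2 ^ m * (u ^ l * v ^ (m - l) / (fact l * fact (m - l)))"
      if "l \<in> {1..<m}" for l
    proof -
      have "(m - 1) choose l \<le> 2 ^ (m - 1)" by (rule binomial_le_pow2)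
      also have "\<dots> \<le> 2 ^ m" by (intro power_increasing) auto
      finally have "real ((m - 1) choose l) \<le> real (2 ^ m)" by (rule of_nat_mono)
      then have c: "real ((m - 1) choose l) \<le> 2 ^ m" by simp
      have "fact K / fact (K + l) \<le> 1 / ((real K + 1) * fact l)"
        using fact_add_ge[of l K] that by (simp add: divide_simps mult_ac)
      then have "real ((m - 1) choose l) * (fact K / fact (K + l)) \<le> 2 ^ m * (1 / ((real K + 1) * fact l))"
        using c by (intro mult_mono) auto
      from mult_right_mono[OF this, of "u ^ l * v ^ (m - l) / fact (m - l)"] pos
      show ?thesis by (simp add: T_def mult_ac)
    qed
    have "(\<Sum>l\<in>{1..<m}. T l) \<le> (\<Sum>l\<in>{1..<m}. 1 / (real K + 1) * 2 ^ m * (u ^ l * v ^ (m - l) / (fact l * fact (m - l))))"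
      by (intro sum_mono T1)
    also have "\<dots> \<le> (\<Sum>l\<le>m. 1 / (real K + 1) * 2 ^ m * (u ^ l * v ^ (m - l) / (fact l * fact (m - l))))"
      using pos by (intro sum_mono2) auto
    also have "\<dots> = 1 / (real K + 1) * ((2 * (u + v)) ^ m / fact m)"
      unfolding sum_distrib_left[symmetric] binomial_exp_term[symmetric] power_mult_distrib[of 2]
      by simp
    finally have "(\<Sum>l\<in>{1..<m}. T l) \<le> \<dots>" .
    moreover have "0 \<le> (\<Sum>l\<in>{1..<m}. T l)" by (intro sum_nonneg T0)
    ultimately show ?thesis
      unfolding f using pos by (intro conjI mult_left_mono) auto
  qed
  show "E * (v ^ m / fact m) \<le> f m"
    and "f m \<le> E * (v ^ m / fact m + 1 / (real K + 1) * ((2 * (u + v)) ^ m / fact m))"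
    using * by auto
qed

text \<open>Both bounds are exponential series in \<open>m\<close>; the upper one also yields
  summability by comparison.\<close>

lemma poisson_P_coeff_suminf_bounds:
  fixes lam t eta1 eta2 p q :: real and K :: nat
  assumes "t > 0" "lam > 0" "eta1 > 0" "eta2 > 0" "p > 0" "q > 0"
  defines "u \<equiv> eta1 / (eta1 + eta2) * (lam * t * p)" and "v \<equiv> eta2 / (eta1 + eta2) * (lam * t * q)"
    and "E \<equiv> exp (- (lam * t)) * (lam * t * p) ^ K / fact K"
    and "f \<equiv> (\<lambda>m. poisson_wt lam t (m + K) * P_coeff eta1 eta2 p q (m + K) K)"
  shows "E * exp v \<le> suminf f"
    and "suminf f \<le> E * (exp v + 1 / (real K + 1) * exp (2 * (u + v)))"
proof -
  have bounds: "E * (v ^ m / fact m) \<le> f m"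
    "f m \<le> E * (v ^ m / fact m + 1 / (real K + 1) * ((2 * (u + v)) ^ m / fact m))" for m
    unfolding f_def u_def v_def E_def by (rule poisson_P_coeff_bounds[OF assms(1-6)])+
  have ex: "(\<lambda>m. x ^ m / fact m) sums exp x" for x :: real
    using exp_converges[of x] by (simp add: field_simps)
  have lo: "(\<lambda>m. E * (v ^ m / fact m)) sums (E * exp v)" by (intro sums_mult ex)
  have hi: "(\<lambda>m. E * (v ^ m / fact m + 1 / (real K + 1) * ((2 * (u + v)) ^ m / fact m)))
      sums (E * (exp v + 1 / (real K + 1) * exp (2 * (u + v))))"
    by (intro sums_mult sums_add ex)
  have pos: "v > 0" "E > 0" using assms by auto
  have f0: "0 \<le> f m" for m
  proof -
    have "0 \<le> E * (v ^ m / fact m)" using pos by simp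
    also note bounds(1)[of m]
    finally show ?thesis .
  qed
  have "summable f"
    by (rule summable_comparison_test'[OF sums_summable[OF hi]]) (use f0 bounds(2) in auto)
  then have "f sums suminf f" by (rule summable_sums)
  show "E * exp v \<le> suminf f" by (rule sums_le[OF bounds(1) lo \<open>f sums _\<close>])
  show "suminf f \<le> E * (exp v + 1 / (real K + 1) * exp (2 * (u + v)))"
    by (rule sums_le[OF bounds(2) \<open>f sums _\<close> hi])
qed

section \<open>Comparison of the power series in L with the Bessel series\<close>

lemma a_coeff_power_bounds:
  fixes lam t eta1 eta2 p q L :: real and k :: nat
  assumes pos: "t > 0" "lam > 0" "eta1 > 0" "eta2 > 0" "p > 0" "q > 0" and "L > 0"
  defines "u \<equiv> eta1 / (eta1 + eta2) * (lam * t * p)" and "v \<equiv> eta2 / (eta1 + eta2) * (lam * t * q)"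
    and "c \<equiv> eta1 * lam * t * p"
  shows "exp (- (lam * t)) * c * (exp v * bessel_term (c * L) k)
      \<le> a_coeff lam eta1 eta2 p q t k * L ^ k"
    and "a_coeff lam eta1 eta2 p q t k * L ^ k \<le>
      exp (- (lam * t)) * c * (exp v * bessel_term (c * L) k
        + exp (2 * (u + v)) * (bessel_term (c * L) k / (real k + 2)))"
proof -
  define F where "F = eta1 ^ (k + 1) / fact k * L ^ k"
  define E where "E = exp (- (lam * t)) * (lam * t * p) ^ (k + 1) / fact (k + 1)"
  define S where "S = (\<Sum>m. poisson_wt lam t (m + (k + 1)) * P_coeff eta1 eta2 p q (m + (k + 1)) (k + 1))"
  have F: "F \<ge> 0" using assms by (simp add: F_def)
  \<comment> \<open>The powers are \<open>k + 1\<close> for \<open>eta1\<close> and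
    \<open>lam * t * p\<close> but only \<open>k\<close> for \<open>L\<close>, so one factor
    \<open>c\<close> stays outside the Bessel term.\<close>
  have FE: "F * E = exp (- (lam * t)) * c * bessel_term (c * L) k"
    by (simp add: F_def E_def c_def bessel_term_def power_mult_distrib mult_ac del: fact_Suc)
  have a: "a_coeff lam eta1 eta2 p q t k * L ^ k = F * S"
    by (simp add: a_coeff_def F_def S_def)
  \<comment> \<open>Taking \<open>K = k + 1\<close> makes the gain \<open>1 / (K + 1)\<close> equal
    to \<open>1 / (k + 2)\<close>.\<close>
  note bounds = poisson_P_coeff_suminf_bounds[OF pos, of "k + 1",
      folded u_def v_def E_def S_def]
  have "F * E * exp v \<le> F * S" using mult_left_mono[OF bounds(1) F] by (simp add: mult_ac)
  then show "exp (- (lam * t)) * c * (exp v * bessel_term (c * L) k)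
      \<le> a_coeff lam eta1 eta2 p q t k * L ^ k"
    unfolding a FE by (simp add: mult_ac)
  have "F * S \<le> F * E * (exp v + exp (2 * (u + v)) / (real k + 2))"
    using mult_left_mono[OF bounds(2) F] by (simp add: mult_ac add_ac)
  then show "a_coeff lam eta1 eta2 p q t k * L ^ k \<le>
      exp (- (lam * t)) * c * (exp v * bessel_term (c * L) k
        + exp (2 * (u + v)) * (bessel_term (c * L) k / (real k + 2)))"
    unfolding a FE by (simp add: algebra_simps)
qed

text \<open>Summation over \<open>k\<close> of the bounds on single terms;
  \<open>bessel_term_divide_sum\<close> converts the gain \<open>1 / (k + 2)\<close> into
  \<open>1 / sqrt (c * L)\<close>.\<close>

lemma a_coeff_series_bounds:
  fixes lam t eta1 eta2 p q L :: real
  assumes pos: "t > 0" "lam > 0" "eta1 > 0" "eta2 > 0" "p > 0" "q > 0" and L: "L > 0"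
  defines "u \<equiv> eta1 / (eta1 + eta2) * (lam * t * p)" and "v \<equiv> eta2 / (eta1 + eta2) * (lam * t * q)"
    and "c \<equiv> eta1 * lam * t * p"
    and "H \<equiv> (\<Sum>k. a_coeff lam eta1 eta2 p q t k * L ^ k)"
    and "S \<equiv> suminf (bessel_term (eta1 * lam * t * p * L))"
  shows "exp (- (lam * t)) * c * (exp v * S) \<le> H"
    and "H \<le> exp (- (lam * t)) * c * (exp v * S + exp (2 * (u + v)) * (S / sqrt (c * L)))"
proof -
  define y where "y = c * L"
  have y: "y > 0" and c: "c > 0" using assms by (auto simp: y_def)
  note bounds = a_coeff_power_bounds[OF pos L, folded u_def v_def c_def, folded y_def]
  define g where "g = (\<lambda>k. a_coeff lam eta1 eta2 p q t k * L ^ k)"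
  have b: "bessel_term y sums S"
    unfolding S_def y_def c_def using assms by (intro summable_sums summable_bessel_term) simp
  have d: "(\<lambda>k. bessel_term y k / (real k + 2)) sums (\<Sum>k. bessel_term y k / (real k + 2))"
    using bessel_term_divide_sum(1)[OF y] by (rule summable_sums)
  have lo: "(\<lambda>k. exp (- (lam * t)) * c * (exp v * bessel_term y k)) sums
      (exp (- (lam * t)) * c * (exp v * S))"
    by (intro sums_mult b)
  have hi: "(\<lambda>k. exp (- (lam * t)) * c * (exp v * bessel_term y k
        + exp (2 * (u + v)) * (bessel_term y k / (real k + 2)))) sums
      (exp (- (lam * t)) * c * (exp v * S + exp (2 * (u + v)) * (\<Sum>k. bessel_term y k / (real k + 2))))"
    by (intro sums_mult sums_add b d)
  have g0: "0 \<le> g k" for k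
    using c bessel_term_nonneg[of y k] y unfolding g_def
    by (intro order.trans[OF _ bounds(1)[of k]]) auto
  have "summable g"
    by (rule summable_comparison_test'[OF sums_summable[OF hi]]) (use g0 bounds(2) in \<open>auto simp: g_def\<close>)
  then have g: "(\<lambda>k. a_coeff lam eta1 eta2 p q t k * L ^ k) sums H"
    unfolding g_def H_def by (rule summable_sums)
  show "exp (- (lam * t)) * c * (exp v * S) \<le> H"
    by (rule sums_le[OF bounds(1) lo g])
  have "H \<le> exp (- (lam * t)) * c * (exp v * S + exp (2 * (u + v)) * (\<Sum>k. bessel_term y k / (real k + 2)))"
    by (rule sums_le[OF bounds(2) g hi])
  also have "\<dots> \<le> exp (- (lam * t)) * c * (exp v * S + exp (2 * (u + v)) * (S / sqrt y))"
    using bessel_term_divide_sum(2)[OF y] c unfolding S_def y_def c_def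
    by (intro mult_left_mono add_left_mono) auto
  finally show "H \<le> exp (- (lam * t)) * c * (exp v * S + exp (2 * (u + v)) * (S / sqrt (c * L)))"
    unfolding y_def .
qed

section \<open>Asymptotics with an explicit relative error\<close>

lemma bessel_main_scale:
  assumes "0 < c" "0 < L"
  shows "c * bessel_main (c * L) =
    1 / (2 * sqrt pi) * c powr (1/4) * L powr (- (3/4)) * exp (2 * sqrt c * sqrt L)"
proof -
  \<comment> \<open>The extra factor \<open>c\<close> accounts for the exponent 1/4 in the final
    constant.\<close>
  have "c * c powr (- (3/4)) = c powr (1/4)"
    using assms powr_add[of c 1 "- (3/4)"] by simp
  then show ?thesis
    using assms by (simp add: bessel_main_def powr_mult real_sqrt_mult mult_ac)
qed

text \<open>Stated in \<open>L\<close> and for all \<open>L > 0\<close>, so that it serves both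
  limits: \<open>L = ln x\<close>, and \<open>L = ln (1 / x)\<close> after exchanging the two
  parameter pairs. The witness is \<open>\<rho> L = H L / G L - 1\<close>.\<close>

lemma a_coeff_series_asymptotics:
  fixes lam t eta1 eta2 p q :: real
  assumes pos: "t > 0" "lam > 0" "eta1 > 0" "eta2 > 0" "p > 0" "q > 0"
  shows "\<exists>D \<rho>. \<forall>L>0. \<bar>\<rho> L\<bar> \<le> D * L powr (- (1/2)) \<and>
    (\<Sum>k. a_coeff lam eta1 eta2 p q t k * L ^ k) =
      1 / (2 * sqrt pi) * (eta1 * lam * t * p) powr (1/4)
      * exp (eta2 * lam * t * q / (eta1 + eta2) - lam * t)
      * L powr (- (3/4)) * exp (2 * sqrt (eta1 * lam * t * p) * sqrt L) * (1 + \<rho> L)"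
proof -
  define u v c where "u = eta1 / (eta1 + eta2) * (lam * t * p)"
    and "v = eta2 / (eta1 + eta2) * (lam * t * q)" and "c = eta1 * lam * t * p"
  define H where "H = (\<lambda>L. \<Sum>k. a_coeff lam eta1 eta2 p q t k * L ^ k)"
  define G where "G = (\<lambda>L. exp (- (lam * t)) * c * (exp v * bessel_main (c * L)))"
  \<comment> \<open>The first summand bounds the error from below, through the lower Bessel bound;
    the second bounds it from above, through the remainder series.\<close>
  define D where "D = 3 / (8 * sqrt c) + exp (2 * (u + v)) / exp v / sqrt c"
  have c: "c > 0" using assms by (simp add: c_def)
  have G_eq: "G L = 1 / (2 * sqrt pi) * (eta1 * lam * t * p) powr (1/4)
      * exp (eta2 * lam * t * q / (eta1 + eta2) - lam * t)
      * L powr (- (3/4)) * exp (2 * sqrt (eta1 * lam * t * p) * sqrt L)" if "L > 0" for L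
  proof -
    have "exp (eta2 * lam * t * q / (eta1 + eta2) - lam * t) = exp (- (lam * t)) * exp v"
      by (simp add: v_def exp_add[symmetric] mult_ac)
    moreover have "G L = exp (- (lam * t)) * exp v * (c * bessel_main (c * L))"
      by (simp add: G_def)
    ultimately show ?thesis
      unfolding bessel_main_scale[OF c that] c_def[symmetric] by (simp add: mult_ac)
  qed
  have main: "\<bar>H L / G L - 1\<bar> \<le> D * L powr (- (1/2)) \<and> H L = G L * (1 + (H L / G L - 1))"
    if L: "L > 0" for L
  proof -
    define S where "S = suminf (bessel_term (c * L))"
    define A where "A = exp (- (lam * t)) * c * exp v"
    define B where "B = exp (2 * (u + v)) / exp v"
    define M where "M = bessel_main (c * L)"
    have cL: "c * L > 0" using c L by simp
    have "A > 0" "B > 0" using c by (auto simp: A_def B_def)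
    have "M > 0" using c L by (simp add: M_def bessel_main_def)
    have G: "G L = A * M" by (simp add: G_def A_def M_def)
    note bounds = a_coeff_series_bounds[OF pos L, folded u_def v_def c_def, folded S_def]
    have h1: "A * S \<le> H L" using bounds(1) by (simp add: A_def H_def mult_ac)
    have h2: "H L \<le> A * (S * (1 + B / sqrt (c * L)))"
      using bounds(2) by (simp add: A_def B_def H_def algebra_simps)
    have S1: "S \<le> M" and S2: "M * (1 - 3 / (8 * sqrt (c * L))) \<le> S"
      unfolding S_def M_def by (rule bessel_series_bounds[OF cL])+
    have "A * (M * (1 - 3 / (8 * sqrt (c * L)))) \<le> H L"
      using h1 mult_left_mono[OF S2, of A] \<open>A > 0\<close> by linarith
    then have l: "1 - 3 / (8 * sqrt (c * L)) \<le> H L / G L"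
      using \<open>A > 0\<close> \<open>M > 0\<close> by (simp add: G pos_le_divide_eq mult_ac)
    have "S * (1 + B / sqrt (c * L)) \<le> M * (1 + B / sqrt (c * L))"
      using S1 \<open>B > 0\<close> cL by (intro mult_right_mono add_nonneg_nonneg) auto
    from mult_left_mono[OF this, of A] h2 have "H L \<le> A * (M * (1 + B / sqrt (c * L)))"
      using \<open>A > 0\<close> by linarith
    then have r: "H L / G L \<le> 1 + B / sqrt (c * L)"
      using \<open>A > 0\<close> \<open>M > 0\<close> by (simp add: G pos_divide_le_eq mult_ac)
    have "D * L powr (- (1/2)) = 3 / (8 * sqrt (c * L)) + B / sqrt (c * L)"
      using L by (simp add: D_def B_def powr_minus powr_half_sqrt real_sqrt_mult field_simps)
    moreover have "3 / (8 * sqrt (c * L)) > 0" "B / sqrt (c * L) > 0"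
      using cL \<open>B > 0\<close> by auto
    ultimately have "\<bar>H L / G L - 1\<bar> \<le> D * L powr (- (1/2))"
      using l r by linarith
    then show ?thesis using G \<open>A > 0\<close> \<open>M > 0\<close> by simp
  qed
  show ?thesis
  proof (intro exI[of _ D] exI[of _ "\<lambda>L. H L / G L - 1"] allI impI)
    fix L :: real assume "L > 0"
    from main[OF this] show "\<bar>H L / G L - 1\<bar> \<le> D * L powr (- (1/2)) \<and>
      (\<Sum>k. a_coeff lam eta1 eta2 p q t k * L ^ k) =
      1 / (2 * sqrt pi) * (eta1 * lam * t * p) powr (1/4)
      * exp (eta2 * lam * t * q / (eta1 + eta2) - lam * t)
      * L powr (- (3/4)) * exp (2 * sqrt (eta1 * lam * t * p) * sqrt L) * (1 + (H L / G L - 1))"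
      unfolding G_eq[OF \<open>L > 0\<close>, symmetric] by (simp only: H_def)
  qed
qed

section \<open>Symmetry of the two coefficient families and passage to the limits in x\<close>

lemma Q_coeff_eq_P_coeff: "Q_coeff eta1 eta2 p q n k = P_coeff eta2 eta1 q p n k"
  unfolding Q_coeff_def P_coeff_def by (auto simp: add.commute mult_ac intro!: sum.cong)

lemma b_coeff_eq_a_coeff: "b_coeff lam eta1 eta2 p q t k = a_coeff lam eta2 eta1 q p t k"
  by (simp add: b_coeff_def a_coeff_def Q_coeff_eq_P_coeff)

theorem theorem12:
  fixes t lam eta1 eta2 p q :: real
  assumes "t > 0" and "lam > 0" and "eta1 > 1" and "eta2 > 0"
    and "p > 0" and "q > 0" and "p + q = 1"
  shows "(\<exists>R \<in> O[at_top](\<lambda>x::real. (ln x) powr (- (1/2))).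
            \<forall>\<^sub>F x in at_top.
              H1 lam eta1 eta2 p q t x =
                1 / (2 * sqrt pi) * (eta1 * lam * t * p) powr (1/4)
                * exp (eta2 * lam * t * q / (eta1 + eta2) - lam * t)
                * (ln x) powr (- (3/4))
                * exp (2 * sqrt (eta1 * lam * t * p) * sqrt (ln x))
                * (1 + R x))
       \<and> (\<exists>R \<in> O[at_right 0](\<lambda>x::real. (ln (1 / x)) powr (- (1/2))).
            \<forall>\<^sub>F x in at_right 0.
              H2 lam eta1 eta2 p q t x =
                1 / (2 * sqrt pi) * (eta2 * lam * t * q) powr (1/4)
                * exp (eta1 * lam * t * p / (eta1 + eta2) - lam * t)
                * (ln (1 / x)) powr (- (3/4))
                * exp (2 * sqrt (eta2 * lam * t * q) * sqrt (ln (1 / x)))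
                * (1 + R x))"
proof
  have eta1: "eta1 > 0" using \<open>eta1 > 1\<close> by simp
  obtain D \<rho> where \<rho>: "\<And>L. L > 0 \<Longrightarrow> \<bar>\<rho> L\<bar> \<le> D * L powr (- (1/2))"
    "\<And>L. L > 0 \<Longrightarrow> (\<Sum>k. a_coeff lam eta1 eta2 p q t k * L ^ k) =
      1 / (2 * sqrt pi) * (eta1 * lam * t * p) powr (1/4)
      * exp (eta2 * lam * t * q / (eta1 + eta2) - lam * t)
      * L powr (- (3/4)) * exp (2 * sqrt (eta1 * lam * t * p) * sqrt L) * (1 + \<rho> L)"
    using a_coeff_series_asymptotics[OF assms(1,2) eta1 assms(4-6)] by blast
  have ev: "\<forall>\<^sub>F x::real in at_top. ln x > 0"
    using eventually_gt_at_top[of 1] by eventually_elim simp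
  show "\<exists>R \<in> O[at_top](\<lambda>x::real. (ln x) powr (- (1/2))).
            \<forall>\<^sub>F x in at_top.
              H1 lam eta1 eta2 p q t x =
                1 / (2 * sqrt pi) * (eta1 * lam * t * p) powr (1/4)
                * exp (eta2 * lam * t * q / (eta1 + eta2) - lam * t)
                * (ln x) powr (- (3/4))
                * exp (2 * sqrt (eta1 * lam * t * p) * sqrt (ln x))
                * (1 + R x)"
  proof (rule bexI[of _ "\<lambda>x. \<rho> (ln x)"])
    show "(\<lambda>x. \<rho> (ln x)) \<in> O[at_top](\<lambda>x::real. (ln x) powr (- (1/2)))"
      by (rule bigoI[of _ D]) (use ev in eventually_elim, simp only: real_norm_def abs_of_nonneg powr_ge_zero \<rho>(1))
  qed (use ev in eventually_elim, simp only: H1_def \<rho>(2))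
next
  have eta1: "eta1 > 0" using \<open>eta1 > 1\<close> by simp
  obtain D \<rho> where \<rho>: "\<And>L. L > 0 \<Longrightarrow> \<bar>\<rho> L\<bar> \<le> D * L powr (- (1/2))"
    "\<And>L. L > 0 \<Longrightarrow> (\<Sum>k. a_coeff lam eta2 eta1 q p t k * L ^ k) =
      1 / (2 * sqrt pi) * (eta2 * lam * t * q) powr (1/4)
      * exp (eta1 * lam * t * p / (eta1 + eta2) - lam * t)
      * L powr (- (3/4)) * exp (2 * sqrt (eta2 * lam * t * q) * sqrt L) * (1 + \<rho> L)"
    \<comment> \<open>The exchanged instance has \<open>eta2 + eta1\<close> in the denominator, so
      the sum is commuted to match the goal.\<close>
    using a_coeff_series_asymptotics[OF assms(1,2,4) eta1 assms(6,5)]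
    unfolding add.commute[of eta2 eta1] by blast
  have ev: "\<forall>\<^sub>F x::real in at_right 0. ln (1 / x) > 0"
    using eventually_at_right_real[of 0 1] by (rule eventually_mono) (simp_all add: ln_div)
  show "\<exists>R \<in> O[at_right 0](\<lambda>x::real. (ln (1 / x)) powr (- (1/2))).
            \<forall>\<^sub>F x in at_right 0.
              H2 lam eta1 eta2 p q t x =
                1 / (2 * sqrt pi) * (eta2 * lam * t * q) powr (1/4)
                * exp (eta1 * lam * t * p / (eta1 + eta2) - lam * t)
                * (ln (1 / x)) powr (- (3/4))
                * exp (2 * sqrt (eta2 * lam * t * q) * sqrt (ln (1 / x)))
                * (1 + R x)"
  proof (rule bexI[of _ "\<lambda>x. \<rho> (ln (1 / x))"])
    show "(\<lambda>x. \<rho> (ln (1 / x))) \<in> O[at_right 0](\<lambda>x::real. (ln (1 / x)) powr (- (1/2)))"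
      by (rule bigoI[of _ D]) (use ev in eventually_elim, simp only: real_norm_def abs_of_nonneg powr_ge_zero \<rho>(1))
  qed (use ev in eventually_elim, simp only: H2_def b_coeff_eq_a_coeff \<rho>(2))
qed

end
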